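(* Let $\Gamma$ be a graph with $m$ edges endowed with a local edge order (leo). The leo is induced by some labeling of the edges of $\Gamma$ by $[m]$ if and only if its medial digraph is a directed acyclic graph (i.e. the leo is e-realizable). Furthermore, when the leo is induced by an edge labeling, the total order of the edges given by the labels is a topological sort of the medial digraph.
   Context: Graphs are finite and loopless; multiple edges are allowed. A local edge order (leo) on a graph $\Gamma$ is an assignment, to each vertex $v$, of a linear order on the set of edges incident to $v$. A bijective labeling of the edges of $\Gamma$ by $[m]=\{1,\dots,m\}$ induces the leo in which the edges at each vertex are ordered by their labels. The medial digraph of a leo is the digraph whose vertices are the edges of $\Gamma$, with an arc from $a$ to $b$ whenever $a$ immediately precedes $b$ in the local order around some vertex. A leo is called e-realizable if its medial digraph has no directed cycles. A topological sort of a digraph is a total order of its vertices such that $u<v$ whenever there is an arc from $u$ to $v$. *)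

theory Defs
  imports "Graph_Theory.Graph_Theory"
begin

section \<open>Undirected multigraphs\<close>

text \<open>
  Edges are abstract objects with a set of endpoints, so that distinct edges may be parallel.
\<close>

record ('v, 'e) multigraph =
  vertices :: "'v set"
  edges :: "'e set"
  ends :: "'e \<Rightarrow> 'v set"

locale finite_loopless_multigraph =
  fixes \<Gamma> :: "('v, 'e) multigraph"
  assumes finite_vertices: "finite (vertices \<Gamma>)"
    and finite_edges: "finite (edges \<Gamma>)"
    and ends_subset: "e \<in> edges \<Gamma> \<Longrightarrow> ends \<Gamma> e \<subseteq> vertices \<Gamma>"
    and card_ends: "e \<in> edges \<Gamma> \<Longrightarrow> card (ends \<Gamma> e) = 2"

definition incident_edges :: "('v, 'e) multigraph \<Rightarrow> 'v \<Rightarrow> 'e set" where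
  "incident_edges \<Gamma> v = {e \<in> edges \<Gamma>. v \<in> ends \<Gamma> e}"


section \<open>Local edge orders\<close>

text \<open>
  Linear orders are reflexive relations, as in \<^const>\<open>linear_order_on\<close>.  The value of a local
  edge order at an element of the type that is not a vertex of the graph is irrelevant.
\<close>

definition local_edge_order :: "('v, 'e) multigraph \<Rightarrow> ('v \<Rightarrow> 'e rel) \<Rightarrow> bool" where
  "local_edge_order \<Gamma> leo \<longleftrightarrow>
     (\<forall>v\<in>vertices \<Gamma>. linear_order_on (incident_edges \<Gamma> v) (leo v))"

definition edge_labeling :: "('v, 'e) multigraph \<Rightarrow> ('e \<Rightarrow> nat) \<Rightarrow> bool" where
  "edge_labeling \<Gamma> l \<longleftrightarrow> bij_betw l (edges \<Gamma>) {1..card (edges \<Gamma>)}"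

definition order_by_label :: "('e \<Rightarrow> nat) \<Rightarrow> 'e set \<Rightarrow> 'e rel" where
  "order_by_label l A = {(a, b). a \<in> A \<and> b \<in> A \<and> l a \<le> l b}"

definition induces_leo ::
  "('v, 'e) multigraph \<Rightarrow> ('e \<Rightarrow> nat) \<Rightarrow> ('v \<Rightarrow> 'e rel) \<Rightarrow> bool" where
  "induces_leo \<Gamma> l leo \<longleftrightarrow>
     (\<forall>v\<in>vertices \<Gamma>. leo v = order_by_label l (incident_edges \<Gamma> v))"


section \<open>The medial digraph\<close>

definition immediately_precedes :: "'e rel \<Rightarrow> 'e \<Rightarrow> 'e \<Rightarrow> bool" where
  "immediately_precedes r a b \<longleftrightarrow>
     (a, b) \<in> r \<and> a \<noteq> b \<and> \<not> (\<exists>c. c \<noteq> a \<and> c \<noteq> b \<and> (a, c) \<in> r \<and> (c, b) \<in> r)"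

text \<open>
  There is at most one arc from \<open>a\<close> to \<open>b\<close>, even if \<open>a\<close> immediately precedes \<open>b\<close> around both of
  their common endpoints.  Opposite arcs between \<open>a\<close> and \<open>b\<close> may both be present; they then form
  a directed cycle of length 2.
\<close>

definition medial_digraph ::
  "('v, 'e) multigraph \<Rightarrow> ('v \<Rightarrow> 'e rel) \<Rightarrow> ('e, 'e \<times> 'e) pre_digraph" where
  "medial_digraph \<Gamma> leo =
     \<lparr> verts = edges \<Gamma>,
       arcs = {(a, b). \<exists>v\<in>vertices \<Gamma>. immediately_precedes (leo v) a b},
       tail = fst,
       head = snd \<rparr>"

definition directed_acyclic :: "('a, 'b) pre_digraph \<Rightarrow> bool" where
  "directed_acyclic D \<longleftrightarrow> \<not> (\<exists>p. pre_digraph.cycle D p)"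

definition e_realizable :: "('v, 'e) multigraph \<Rightarrow> ('v \<Rightarrow> 'e rel) \<Rightarrow> bool" where
  "e_realizable \<Gamma> leo \<longleftrightarrow> directed_acyclic (medial_digraph \<Gamma> leo)"

definition topological_sort :: "('a, 'b) pre_digraph \<Rightarrow> 'a rel \<Rightarrow> bool" where
  "topological_sort D r \<longleftrightarrow>
     linear_order_on (verts D) r \<and>
     (\<forall>e\<in>arcs D. (tail D e, head D e) \<in> r \<and> tail D e \<noteq> head D e)"

end

theory Submission
  imports Defs
begin

text \<open>
  The labels increase along every arc of the medial digraph of an induced local edge order, because
  each arc records a comparison in one of the local orders.  So the labels sort the medial digraph
  topologically, and a digraph with a numbering that increases along its arcs has no directed cycle.

  Conversely, a finite acyclic digraph has a topological numbering of its vertices by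
  \<open>1, \<dots>, m\<close> (\<open>ex_topological_numbering\<close>).  Apply this to the medial digraph.  The arcs
  only constrain pairs of edges that are neighbours in a local order, but this is enough: in a finite
  order, any two comparable elements are joined by a chain of immediate successors
  (\<open>trancl_immediately_precedes\<close>), so that the labels increase along the whole local order
  around each vertex.  A linear order along which an injective numbering increases is the order
  given by this numbering (\<open>linear_order_eq_order_by_label\<close>), so the local edge order is
  induced by the labels.
\<close>

section \<open>Linear orders and labels\<close>

text \<open>
  If \<open>b\<close> does not immediately follow \<open>a\<close>, then some \<open>c\<close> lies strictly between them, and both
  intervals \<open>[a, c]\<close> and \<open>[c, b]\<close> are smaller than \<open>[a, b]\<close>.  Finiteness ends this subdivision.
\<close>

lemma trancl_immediately_precedes:
  assumes "finite A" and po: "partial_order_on A r"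
    and "(a, b) \<in> r" and "a \<noteq> b"
  shows "(a, b) \<in> {(x, y). immediately_precedes r x y}\<^sup>+"
  using \<open>(a, b) \<in> r\<close> \<open>a \<noteq> b\<close>
proof (induction "card {c. (a, c) \<in> r \<and> (c, b) \<in> r}" arbitrary: a b rule: less_induct)
  case less
  let ?I = "\<lambda>x y. {c. (x, c) \<in> r \<and> (c, y) \<in> r}"
  note trans = partial_order_onD(2)[OF po, THEN transD]
  note antisym = partial_order_onD(3)[OF po, THEN antisymD]
  show ?case
  proof (cases "immediately_precedes r a b")
    case True
    then show ?thesis by blast
  next
    case False
    with less.prems obtain c where c: "c \<noteq> a" "c \<noteq> b" "(a, c) \<in> r" "(c, b) \<in> r"
      unfolding immediately_precedes_def by blast
    have "a \<in> A" "b \<in> A"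
      using less.prems partial_order_onD(4)[OF po] by auto
    then have refl: "(a, a) \<in> r" "(b, b) \<in> r"
      using partial_order_onD(1)[OF po] by (auto dest: refl_onD)
    have fin: "finite (?I a b)"
      using \<open>finite A\<close> partial_order_onD(4)[OF po] by (auto intro: finite_subset)
    have "?I a c \<subset> ?I a b"
    proof
      show "?I a c \<subseteq> ?I a b" using c(4) trans by blast
      show "?I a c \<noteq> ?I a b" using less.prems(1) refl(2) c(2,4) antisym by blast
    qed
    then have "(a, c) \<in> {(x, y). immediately_precedes r x y}\<^sup>+"
      using less.hyps[of a c] c fin by (simp add: psubset_card_mono)
    moreover have "?I c b \<subset> ?I a b"
    proof
      show "?I c b \<subseteq> ?I a b" using c(3) trans by blast
      show "?I c b \<noteq> ?I a b" using less.prems(1) refl(1) c(1,3) antisym by blast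
    qed
    then have "(c, b) \<in> {(x, y). immediately_precedes r x y}\<^sup>+"
      using less.hyps[of c b] c fin by (simp add: psubset_card_mono)
    ultimately show ?thesis by (rule trancl_trans)
  qed
qed

lemma linear_order_on_order_by_label:
  assumes "inj_on l A"
  shows "linear_order_on A (order_by_label l A)"
  using assms
  unfolding order_on_defs order_by_label_def refl_on_def trans_def antisym_def total_on_def
  by (auto dest: inj_onD)

text \<open>
  Totality gives the inclusion that is not assumed: two elements ordered by their labels are
  comparable, and the reverse comparison would contradict the labels.
\<close>

lemma linear_order_eq_order_by_label:
  assumes lin: "linear_order_on A r"
    and mono: "\<And>a b. (a, b) \<in> r \<Longrightarrow> a \<noteq> b \<Longrightarrow> l a < l b"
  shows "r = order_by_label l A"
proof (intro set_eqI iffI; clarify)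
  fix a b assume ab: "(a, b) \<in> r"
  then have "a \<in> A" "b \<in> A"
    using lin unfolding order_on_defs by auto
  moreover have "l a \<le> l b"
    using mono[OF ab] by (cases "a = b") auto
  ultimately show "(a, b) \<in> order_by_label l A"
    unfolding order_by_label_def by simp
next
  fix a b assume "(a, b) \<in> order_by_label l A"
  then have ab: "a \<in> A" "b \<in> A" "l a \<le> l b"
    unfolding order_by_label_def by auto
  then have "(a, b) \<in> r \<or> (b, a) \<in> r"
    using lin unfolding order_on_defs total_on_def refl_on_def by metis
  moreover have "(b, a) \<in> r \<Longrightarrow> a = b"
    using mono[of b a] ab(3) by fastforce
  ultimately show "(a, b) \<in> r" by blast
qed

section \<open>Acyclic digraphs\<close>

text \<open>
  A cycle visits no vertex twice, whereas a loop in the transitive closure only yields a closed walk;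
  such a walk contains a cycle.
\<close>

lemma directed_acyclic_iff_acyclic:
  assumes "wf_digraph D"
  shows "directed_acyclic D \<longleftrightarrow> acyclic (arcs_ends D)"
proof -
  interpret wf_digraph D by fact
  have "(\<exists>p. cycle p) \<longleftrightarrow> (\<exists>p. closed_w p)"
    using closed_w_imp_cycle by (auto simp: cycle_altdef)
  also have "\<dots> \<longleftrightarrow> (\<exists>u. (u, u) \<in> (arcs_ends D)\<^sup>+)"
    unfolding closed_w_def reachable1_awalk by auto
  finally show ?thesis
    unfolding directed_acyclic_def acyclic_def by blast
qed

lemma acyclic_if_numbering_increases:
  fixes l :: "'a \<Rightarrow> nat"
  assumes "\<And>a b. (a, b) \<in> R \<Longrightarrow> l a < l b"
  shows "acyclic R"
proof (rule wf_acyclic, rule wf_subset)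
  show "R \<subseteq> measure l" using assms by auto
qed simp

text \<open>
  An acyclic relation has a sink in a nonempty finite set.  The sink can receive the largest label,
  because it is only ever the target of an arc, and the remaining elements are numbered recursively.
\<close>

lemma ex_topological_numbering:
  assumes "finite A" and "acyclic R" and "R \<subseteq> A \<times> A"
  shows "\<exists>l. bij_betw l A {1..card A} \<and> (\<forall>(a, b)\<in>R. l a < l b)"
  using assms
proof (induction "card A" arbitrary: A R)
  case 0
  then show ?case by (auto simp: bij_betw_def)
next
  case (Suc n)
  have "finite R"
    using Suc.prems finite_subset by blast
  then have "wf (R\<inverse>)"
    using Suc.prems(2) by (rule finite_acyclic_wf_converse)
  moreover obtain x where "x \<in> A"
    using Suc.hyps(2) by fastforce
  ultimately obtain z where z: "z \<in> A" and "\<And>y. (y, z) \<in> R\<inverse> \<Longrightarrow> y \<notin> A"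
    by (auto elim: wfE_min)
  then have sink: "(z, y) \<notin> R" for y
    using Suc.prems(3) by auto
  let ?B = "A - {z}"
  have card: "n = card ?B"
    using Suc.hyps(2) Suc.prems(1) z by simp
  have "acyclic (R \<inter> ?B \<times> ?B)"
    using Suc.prems(2) by (rule acyclic_subset) blast
  with Suc.hyps(1)[OF card, of "R \<inter> ?B \<times> ?B"] Suc.prems(1) obtain l
    where l: "bij_betw l ?B {1..n}" "\<forall>(a, b)\<in>R \<inter> ?B \<times> ?B. l a < l b"
    unfolding card by auto
  let ?l = "l(z := Suc n)"
  have "bij_betw ?l ?B {1..n}"
    using l(1) by (rule bij_betw_cong[THEN iffD1, rotated]) auto
  then have "bij_betw ?l (?B \<union> {z}) ({1..n} \<union> {?l z})"
    by (intro notIn_Un_bij_betw) auto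
  moreover have "?B \<union> {z} = A" "{1..n} \<union> {?l z} = {1..card A}"
    using z Suc.hyps(2) by auto
  ultimately have "bij_betw ?l A {1..card A}" by simp
  moreover have "?l a < ?l b" if "(a, b) \<in> R" for a b
  proof -
    have a: "a \<in> ?B" "b \<in> A"
      using that Suc.prems(3) sink by auto
    then have "l a \<le> n"
      using l(1) by (auto dest: bij_betwE)
    with a that l(2) show ?thesis by auto
  qed
  ultimately show ?case by blast
qed

section \<open>The medial digraph\<close>

lemma arcs_ends_medial_digraph:
  "arcs_ends (medial_digraph \<Gamma> leo) = {(a, b). \<exists>v\<in>vertices \<Gamma>. immediately_precedes (leo v) a b}"
  by (simp add: arcs_ends_conv medial_digraph_def)

lemma arcs_ends_medial_digraph_subset:
  assumes "local_edge_order \<Gamma> leo"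
  shows "arcs_ends (medial_digraph \<Gamma> leo) \<subseteq> edges \<Gamma> \<times> edges \<Gamma>"
  using assms
  unfolding arcs_ends_medial_digraph local_edge_order_def order_on_defs
    immediately_precedes_def incident_edges_def
  by blast

lemma wf_digraph_medial_digraph:
  assumes "local_edge_order \<Gamma> leo"
  shows "wf_digraph (medial_digraph \<Gamma> leo)"
  using arcs_ends_medial_digraph_subset[OF assms]
  by unfold_locales (force simp: arcs_ends_conv medial_digraph_def)+

lemma e_realizable_iff_acyclic:
  assumes "local_edge_order \<Gamma> leo"
  shows "e_realizable \<Gamma> leo \<longleftrightarrow> acyclic (arcs_ends (medial_digraph \<Gamma> leo))"
  unfolding e_realizable_def
  using wf_digraph_medial_digraph[OF assms] by (rule directed_acyclic_iff_acyclic)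

text \<open>
  The inequality is strict because the ends of an arc are distinct edges and a labeling is injective.
\<close>

lemma label_increases_along_medial_arc:
  assumes "edge_labeling \<Gamma> l" and "induces_leo \<Gamma> l leo"
    and "(a, b) \<in> arcs_ends (medial_digraph \<Gamma> leo)"
  shows "l a < l b"
proof -
  from assms(2,3) have ab: "a \<in> edges \<Gamma>" "b \<in> edges \<Gamma>" "a \<noteq> b" "l a \<le> l b"
    unfolding arcs_ends_medial_digraph immediately_precedes_def induces_leo_def
      order_by_label_def incident_edges_def by auto
  moreover have "inj_on l (edges \<Gamma>)"
    using assms(1) unfolding edge_labeling_def by (rule bij_betw_imp_inj_on)
  ultimately have "l a \<noteq> l b"
    by (auto dest: inj_onD)
  with ab(4) show ?thesis by simp
qed

lemma topological_sort_order_by_label: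
  assumes "local_edge_order \<Gamma> leo" and "edge_labeling \<Gamma> l" and "induces_leo \<Gamma> l leo"
  shows "topological_sort (medial_digraph \<Gamma> leo) (order_by_label l (edges \<Gamma>))"
proof -
  have "inj_on l (edges \<Gamma>)"
    using assms(2) unfolding edge_labeling_def by (rule bij_betw_imp_inj_on)
  then have "linear_order_on (edges \<Gamma>) (order_by_label l (edges \<Gamma>))"
    by (rule linear_order_on_order_by_label)
  moreover have "(a, b) \<in> order_by_label l (edges \<Gamma>) \<and> a \<noteq> b"
    if "(a, b) \<in> arcs_ends (medial_digraph \<Gamma> leo)" for a b
    using label_increases_along_medial_arc[OF assms(2,3) that]
      arcs_ends_medial_digraph_subset[OF assms(1)] that
    unfolding order_by_label_def by auto
  ultimately show ?thesis
    unfolding topological_sort_def by (auto simp: arcs_ends_conv medial_digraph_def)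
qed

text \<open>
  Increasing labels along the arcs are a condition on neighbours only; it propagates along chains of
  immediate successors to all pairs in a local order.
\<close>

lemma induces_leo_if_label_increases:
  assumes "finite_loopless_multigraph \<Gamma>" and "local_edge_order \<Gamma> leo"
    and mono: "\<And>a b. (a, b) \<in> arcs_ends (medial_digraph \<Gamma> leo) \<Longrightarrow> l a < l b"
  shows "induces_leo \<Gamma> l leo"
  unfolding induces_leo_def
proof
  fix v assume v: "v \<in> vertices \<Gamma>"
  interpret finite_loopless_multigraph \<Gamma> by fact
  have fin: "finite (incident_edges \<Gamma> v)"
    using finite_edges unfolding incident_edges_def by simp
  have lin: "linear_order_on (incident_edges \<Gamma> v) (leo v)"
    using assms(2) v unfolding local_edge_order_def by blast
  then have po: "partial_order_on (incident_edges \<Gamma> v) (leo v)"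
    unfolding linear_order_on_def by blast
  show "leo v = order_by_label l (incident_edges \<Gamma> v)"
    using lin
  proof (rule linear_order_eq_order_by_label)
    fix a b assume "(a, b) \<in> leo v" "a \<noteq> b"
    with fin po have "(a, b) \<in> {(x, y). immediately_precedes (leo v) x y}\<^sup>+"
      by (rule trancl_immediately_precedes)
    then show "l a < l b"
    proof induction
      case (base y)
      with mono v show ?case unfolding arcs_ends_medial_digraph by blast
    next
      case (step y z)
      then have "l y < l z"
        using mono v unfolding arcs_ends_medial_digraph by blast
      with step.IH show ?case by simp
    qed
  qed
qed

theorem proposition2p13:
  fixes \<Gamma> :: "('v, 'e) multigraph" and leo :: "'v \<Rightarrow> 'e rel"
  assumes "finite_loopless_multigraph \<Gamma>"
    and "local_edge_order \<Gamma> leo"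
  shows "((\<exists>l. edge_labeling \<Gamma> l \<and> induces_leo \<Gamma> l leo) \<longleftrightarrow> e_realizable \<Gamma> leo) \<and>
    (\<forall>l. edge_labeling \<Gamma> l \<and> induces_leo \<Gamma> l leo \<longrightarrow>
       topological_sort (medial_digraph \<Gamma> leo) (order_by_label l (edges \<Gamma>)))"
proof (intro conjI iffI allI impI)
  assume "\<exists>l. edge_labeling \<Gamma> l \<and> induces_leo \<Gamma> l leo"
  then obtain l where "edge_labeling \<Gamma> l" "induces_leo \<Gamma> l leo" by blast
  then have "acyclic (arcs_ends (medial_digraph \<Gamma> leo))"
    by (intro acyclic_if_numbering_increases label_increases_along_medial_arc)
  then show "e_realizable \<Gamma> leo"
    by (simp add: e_realizable_iff_acyclic[OF assms(2)])
next
  assume "e_realizable \<Gamma> leo"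
  then have "acyclic (arcs_ends (medial_digraph \<Gamma> leo))"
    by (simp add: e_realizable_iff_acyclic[OF assms(2)])
  then obtain l where "edge_labeling \<Gamma> l"
    and "\<forall>(a, b)\<in>arcs_ends (medial_digraph \<Gamma> leo). l a < l b"
    using ex_topological_numbering[OF finite_loopless_multigraph.finite_edges[OF assms(1)]]
      arcs_ends_medial_digraph_subset[OF assms(2)]
    unfolding edge_labeling_def by metis
  then show "\<exists>l. edge_labeling \<Gamma> l \<and> induces_leo \<Gamma> l leo"
    using induces_leo_if_label_increases[OF assms] by blast
next
  fix l assume "edge_labeling \<Gamma> l \<and> induces_leo \<Gamma> l leo"
  then show "topological_sort (medial_digraph \<Gamma> leo) (order_by_label l (edges \<Gamma>))"
    using topological_sort_order_by_label[OF assms(2)] by blast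
qed

end
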